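(* There is an absolute constant $c_0>0$ such that the following holds. Let $n\ge 1$, $N=2^n$, and let $C,D\in\mathbb{R}$ be such that $a_m:=C+mD\ge 0$ for all $0\le m\le N-1$. Let $A=\mathrm{diag}(s_0,\dots,s_{N-1})$ with $s_m=a_m+i\,a_m$, and let $L=\frac{A+A^\dagger}{2}$, $H=\frac{A-A^\dagger}{2i}$ (so that $L=H=\mathrm{diag}(a_0,\dots,a_{N-1})$). Let $K,T>0$, $\beta\in(0,1)$, and let $g:[0,\infty)\to\mathbb{C}$ be a function with $g\in L^1(\mathbb{R}_+)$. Let $k_j,t_\ell,c_j,\hat c_\ell$ ($0\le j,\ell\le N-1$) be the quadrature nodes and coefficients defined in the context, with $\hat c\neq 0$. Let $U_1,U_2$ be any $n$-qubit unitaries with $$U_1|0^n\rangle=\sum_{j=0}^{N-1}\sqrt{\frac{c_j}{\|c\|_1}}\,|j\rangle,\qquad U_2|0^n\rangle=\sum_{\ell=0}^{N-1}\sqrt{\frac{\hat c_\ell}{\|\hat c\|_1}}\,|\ell\rangle .$$ Then there is a quantum circuit on $3n=O(\log N)$ qubits (an $n$-qubit register $j$, an $n$-qubit register $\ell$, and an $n$-qubit system register) that uses each of $U_1,U_2$ and each of their transposes $U_1^{T},U_2^{T}$ exactly once, together with at most $c_0(\log_2 N)^3$ further gates, each of which is a single-qubit phase-shift gate or a single-qubit $R_Z$ rotation with at most two control qubits, such that the unitary $W$ implemented by the circuit satisfies $$(\langle 0^n|\otimes\langle 0^n|\otimes I_N)\,W\,(|0^n\rangle\otimes|0^n\rangle\otimes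 I_N)=\frac{1}{\|c\|_1\|\hat c\|_1}\sum_{j=0}^{N-1}\sum_{\ell=0}^{N-1}c_j\,\hat c_\ell\,e^{-i t_\ell(k_jL+H)} .$$
   Context: The double sum is the discretization (quadrature) of $$h(A)=\int_0^\infty g(t)e^{-At}\,dt=\int_0^\infty\int_{\mathbb{R}}\frac{f(k)g(t)}{1-ik}e^{-it(kL+H)}\,dk\,dt,$$ whose diagonal entries are the Laplace transform of $g$ at the points $s_0,\dots,s_{N-1}$; here $f(k)=\dfrac{1}{2\pi e^{-2^\beta}e^{(1+ik)^\beta}}$ (principal branch of the power). Nodes and coefficients, with $N$ points in each variable: $h_k=2K/N$, $h_t=T/N$, $k_j=-K+jh_k$, $t_\ell=\ell h_t$ for $0\le j,\ell\le N-1$; $c_j=h_k f(k_j)/(1-ik_j)$ and $\hat c_\ell=h_t\,g(t_\ell)$. $\|c\|_1=\sum_j|c_j|$ and $\|\hat c\|_1=\sum_\ell|\hat c_\ell|$. A fixed choice of complex square root is made for each coefficient. $U^{T}$ denotes the matrix transpose (not the conjugate transpose) in the computational basis. $I_N$ is the identity on the system register. Phase-shift gate: $\mathrm{diag}(1,e^{i\phi})$; $R_Z(\phi)=e^{-i\phi Z/2}$ with $Z=\mathrm{diag}(1,-1)$; $\phi$ is an arbitrary real number. A gate $V$ with control qubits acts as $V$ on the target when all control qubits are $|1\rangle$ and as the identity otherwise. *)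

theory Defs
  imports "HOL-Analysis.Analysis" "Jordan_Normal_Form.Schur_Decomposition"
begin

hide_const (open) Finite_Cartesian_Product.mat

text \<open>Matrices\<close>

definition unitary_mat :: "nat \<Rightarrow> complex mat \<Rightarrow> bool" where
  "unitary_mat N U \<longleftrightarrow>
     U \<in> carrier_mat N N \<and> U * mat_adjoint U = 1\<^sub>m N \<and> mat_adjoint U * U = 1\<^sub>m N"

definition kron :: "complex mat \<Rightarrow> complex mat \<Rightarrow> complex mat" where
  "kron A B = mat (dim_row A * dim_row B) (dim_col A * dim_col B)
     (\<lambda>(i, j). A $$ (i div dim_row B, j div dim_col B) * B $$ (i mod dim_row B, j mod dim_col B))"

text \<open>The type of matrices has no zero element independent of the dimensions, so the library's
  big operators do not apply to it. The dimensions of the sum are therefore arguments.\<close>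

definition msum :: "nat \<Rightarrow> nat \<Rightarrow> (nat \<Rightarrow> complex mat) \<Rightarrow> nat set \<Rightarrow> complex mat" where
  "msum nr nc F I = mat nr nc (\<lambda>(a, b). \<Sum>i\<in>I. F i $$ (a, b))"

text \<open>The exponential series of a square matrix, summed entrywise.\<close>

definition mat_exp :: "complex mat \<Rightarrow> complex mat" where
  "mat_exp A = mat (dim_row A) (dim_row A)
     (\<lambda>(a, b). \<Sum>m. (A ^\<^sub>m m) $$ (a, b) / fact m)"

definition ket :: "nat \<Rightarrow> nat \<Rightarrow> complex mat" where
  "ket N j = mat N 1 (\<lambda>(i, _). if i = j then 1 else 0)"

definition bra :: "nat \<Rightarrow> nat \<Rightarrow> complex mat" where
  "bra N j = mat_adjoint (ket N j)"

text \<open>Circuits on qubits 0, ..., w - 1. Qubit 0 is the most significant bit of a basis index, in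
  accordance with \<^const>\<open>kron\<close>.\<close>

definition qubit_val :: "nat \<Rightarrow> nat \<Rightarrow> nat \<Rightarrow> nat" where
  "qubit_val w x q = (x div 2 ^ (w - 1 - q)) mod 2"

definition local_index :: "nat \<Rightarrow> nat list \<Rightarrow> nat \<Rightarrow> nat" where
  "local_index w qs x = foldl (\<lambda>v q. 2 * v + qubit_val w x q) 0 qs"

text \<open>The operator on w qubits that acts as V on the qubits qs (first entry of qs = most
  significant qubit of V) and as the identity on the others.\<close>

definition apply_on :: "nat \<Rightarrow> nat list \<Rightarrow> complex mat \<Rightarrow> complex mat" where
  "apply_on w qs V = mat (2 ^ w) (2 ^ w) (\<lambda>(x, y).
     if \<forall>q<w. q \<notin> set qs \<longrightarrow> qubit_val w x q = qubit_val w y q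
     then V $$ (local_index w qs x, local_index w qs y) else 0)"

definition phase_mat :: "real \<Rightarrow> complex mat" where
  "phase_mat \<phi> = mat_diag 2 (\<lambda>i. if i = 0 then 1 else exp (\<i> * of_real \<phi>))"

definition pauli_Z :: "complex mat" where
  "pauli_Z = mat_diag 2 (\<lambda>i. if i = 0 then 1 else - 1)"

definition RZ_mat :: "real \<Rightarrow> complex mat" where
  "RZ_mat \<phi> = mat_exp ((- \<i> * of_real \<phi> / 2) \<cdot>\<^sub>m pauli_Z)"

text \<open>A single-qubit gate V with k control qubits; the controls are the k most significant qubits,
  so V acts on the last two basis states.\<close>

definition controlled :: "nat \<Rightarrow> complex mat \<Rightarrow> complex mat" where
  "controlled k V = (let d = 2 ^ (k + 1) - 2 in
     four_block_mat (1\<^sub>m d) (0\<^sub>m d 2) (0\<^sub>m 2 d) V)"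

datatype query_gate = U1_gate | U2_gate | U1T_gate | U2T_gate

fun query_mat :: "complex mat \<Rightarrow> complex mat \<Rightarrow> query_gate \<Rightarrow> complex mat" where
  "query_mat U1 U2 U1_gate = U1"
| "query_mat U1 U2 U2_gate = U2"
| "query_mat U1 U2 U1T_gate = transpose_mat U1"
| "query_mat U1 U2 U2T_gate = transpose_mat U2"

text \<open>The arguments of \<open>RZ\<close> are the angle, the control qubits and the target qubit.\<close>

datatype gate = Query query_gate "nat list" | Phase real nat | RZ real "nat list" nat

fun valid_gate :: "nat \<Rightarrow> nat \<Rightarrow> gate \<Rightarrow> bool" where
  "valid_gate n w (Query u qs) \<longleftrightarrow> length qs = n \<and> distinct qs \<and> set qs \<subseteq> {..<w}"
| "valid_gate n w (Phase \<phi> q) \<longleftrightarrow> q < w"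
| "valid_gate n w (RZ \<phi> cs q) \<longleftrightarrow>
     length cs \<le> 2 \<and> distinct (cs @ [q]) \<and> set (cs @ [q]) \<subseteq> {..<w}"

fun gate_mat :: "nat \<Rightarrow> complex mat \<Rightarrow> complex mat \<Rightarrow> gate \<Rightarrow> complex mat" where
  "gate_mat w U1 U2 (Query u qs) = apply_on w qs (query_mat U1 U2 u)"
| "gate_mat w U1 U2 (Phase \<phi> q) = apply_on w [q] (phase_mat \<phi>)"
| "gate_mat w U1 U2 (RZ \<phi> cs q) = apply_on w (cs @ [q]) (controlled (length cs) (RZ_mat \<phi>))"

text \<open>The first gate of the list is applied first.\<close>

fun circuit_mat :: "nat \<Rightarrow> complex mat \<Rightarrow> complex mat \<Rightarrow> gate list \<Rightarrow> complex mat" where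
  "circuit_mat w U1 U2 [] = 1\<^sub>m (2 ^ w)"
| "circuit_mat w U1 U2 (G # Gs) = circuit_mat w U1 U2 Gs * gate_mat w U1 U2 G"

fun is_query :: "gate \<Rightarrow> bool" where
  "is_query (Query u qs) \<longleftrightarrow> True"
| "is_query _ \<longleftrightarrow> False"

definition query_count :: "query_gate \<Rightarrow> gate list \<Rightarrow> nat" where
  "query_count u Gs = length (filter (\<lambda>G. \<exists>qs. G = Query u qs) Gs)"

definition elementary_count :: "gate list \<Rightarrow> nat" where
  "elementary_count Gs = length (filter (\<lambda>G. \<not> is_query G) Gs)"

text \<open>Quadrature nodes and coefficients\<close>

definition kernel :: "real \<Rightarrow> real \<Rightarrow> complex" where
  "kernel \<beta> k = 1 / (2 * of_real pi * of_real (exp (- (2 powr \<beta>)))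
                    * exp ((1 + \<i> * of_real k) powr of_real \<beta>))"

definition k_node :: "real \<Rightarrow> nat \<Rightarrow> nat \<Rightarrow> real" where
  "k_node K N j = - K + real j * (2 * K / real N)"

definition t_node :: "real \<Rightarrow> nat \<Rightarrow> nat \<Rightarrow> real" where
  "t_node T N l = real l * (T / real N)"

definition k_coeff :: "real \<Rightarrow> real \<Rightarrow> nat \<Rightarrow> nat \<Rightarrow> complex" where
  "k_coeff \<beta> K N j =
     of_real (2 * K / real N) * kernel \<beta> (k_node K N j) / (1 - \<i> * of_real (k_node K N j))"

definition t_coeff :: "(real \<Rightarrow> complex) \<Rightarrow> real \<Rightarrow> nat \<Rightarrow> nat \<Rightarrow> complex" where
  "t_coeff g T N l = of_real (T / real N) * g (t_node T N l)"

definition one_norm :: "nat \<Rightarrow> (nat \<Rightarrow> complex) \<Rightarrow> real" where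
  "one_norm N c = (\<Sum>j<N. cmod (c j))"

end

(* Write j, l, m for the values of the three registers. The phase -t_l (k_j + 1) a_m is t_l, linear in
   the bits of l, times two affine functions of the bits of j and of m, so it is a sum of n^3 terms that
   each involve three bits; each term costs four gates. Between U_1 (x) U_2 and its transpose this
   diagonal gives M^T D M, where the 0-columns of M carry the square roots of the coefficients: the
   transpose, unlike the adjoint, squares these amplitudes without conjugating them. *)
theory Submission
  imports Defs
begin

section \<open>Bits and register values of a basis index\<close>

lemma local_index_snoc: "local_index w (qs @ [q]) x = 2 * local_index w qs x + qubit_val w x q"
  by (simp add: local_index_def)

lemma local_index_Nil [simp]: "local_index w [] x = 0"
  by (simp add: local_index_def)

lemma qubit_val_less [simp]: "qubit_val w x q < 2"
  by (simp add: qubit_val_def)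

lemma local_index_less: "local_index w qs x < 2 ^ length qs"
proof (induction qs rule: rev_induct)
  case (snoc q qs)
  have "2 * a + u < 2 * b" if "a < b" "u < 2" for a b u :: nat
    using that by presburger
  from this[OF snoc qubit_val_less] show ?case
    by (simp add: local_index_snoc)
qed simp

text \<open>Binary expansions of a fixed length are unique.\<close>

lemma local_index_eq_iff:
  "local_index w qs x = local_index w qs y \<longleftrightarrow> (\<forall>q\<in>set qs. qubit_val w x q = qubit_val w y q)"
proof (induction qs rule: rev_induct)
  case (snoc q qs)
  have "2 * a + u = 2 * b + v \<longleftrightarrow> a = b \<and> u = v" if "u < 2" "v < 2" for a b u v :: nat
    using that by presburger
  with snoc show ?case by (auto simp: local_index_snoc)
qed simp

text \<open>Qubit 0 is the most significant, so consecutive qubits are consecutive binary digits of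
  x: the division drops the qubits after the block and the remainder drops those before it.\<close>

lemma local_index_upt:
  "a + k \<le> w \<Longrightarrow> local_index w [a..<a + k] x = x div 2 ^ (w - (a + k)) mod 2 ^ k"
proof (induction k)
  case (Suc k)
  define y where "y = x div 2 ^ (w - (a + Suc k))"
  have e: "w - (a + k) = Suc (w - (a + Suc k))" using Suc.prems by simp
  have "x div 2 ^ (w - (a + k)) = y div 2"
    by (simp only: e y_def power_Suc2 div_mult2_eq)
  moreover have "y mod 2 ^ Suc k = 2 * (y div 2 mod 2 ^ k) + y mod 2"
    by (simp add: mod_mult2_eq)
  ultimately show ?case
    using Suc by (simp add: local_index_snoc qubit_val_def y_def)
qed simp

text \<open>This makes a register value linear in its bits, so that a product of affine functions of
  registers splits into terms with one bit per register.\<close>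

lemma local_index_upt_sum:
  "real (local_index w [a..<a + n] x) = (\<Sum>p<n. 2 ^ (n - 1 - p) * real (qubit_val w x (a + p)))"
proof (induction n)
  case (Suc n)
  \<comment> \<open>Appending a bit doubles the weights of the earlier ones; p < n keeps the
    subtraction n - 1 - p from truncating.\<close>
  have "2 * 2 ^ (n - 1 - p) = (2::real) ^ (n - p)" if "p < n" for p
    using that by (simp flip: power_Suc add: Suc_diff_Suc)
  then have "2 * (\<Sum>p<n. 2 ^ (n - 1 - p) * real (qubit_val w x (a + p))) =
      (\<Sum>p<n. 2 ^ (n - p) * real (qubit_val w x (a + p)))"
    by (auto simp: sum_distrib_left mult.assoc[symmetric] intro!: sum.cong)
  with Suc show ?case by (simp add: local_index_snoc)
qed simp

text \<open>Reading all w qubits in order returns the index itself, so this is an instance of the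
  uniqueness of binary expansions.\<close>

lemma eq_iff_qubit_val:
  assumes "x < 2 ^ w" "y < 2 ^ w"
  shows "x = y \<longleftrightarrow> (\<forall>q<w. qubit_val w x q = qubit_val w y q)"
  using local_index_upt[of 0 w w x] local_index_upt[of 0 w w y]
    local_index_eq_iff[of w "[0..<w]" x y] assms by auto

section \<open>Transposes, and gates that are diagonal matrices\<close>

text \<open>The condition that x and y agree outside \<open>qs\<close> is symmetric in x and y.
  Hence a query to a transpose is the transpose of the query as an operator on all w qubits.\<close>

lemma apply_on_transpose:
  assumes "V \<in> carrier_mat (2 ^ length qs) (2 ^ length qs)"
  shows "apply_on w qs (transpose_mat V) = transpose_mat (apply_on w qs V)"
  using assms local_index_less[of w qs] by (intro eq_matI) (auto simp: apply_on_def)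

text \<open>A nonzero entry needs x and y to agree outside \<open>qs\<close>, and the diagonal makes
  their readings on \<open>qs\<close> equal; together this is x = y.\<close>

lemma apply_on_mat_diag:
  "apply_on w qs (mat_diag (2 ^ length qs) d) = mat_diag (2 ^ w) (\<lambda>x. d (local_index w qs x))"
proof (intro eq_matI)
  fix x y assume "x < dim_row (mat_diag (2 ^ w) (\<lambda>x. d (local_index w qs x)))"
    "y < dim_col (mat_diag (2 ^ w) (\<lambda>x. d (local_index w qs x)))"
  then have xy: "x < 2 ^ w" "y < 2 ^ w" by (auto simp: mat_diag_def)
  have "x = y \<longleftrightarrow> (\<forall>q<w. q \<notin> set qs \<longrightarrow> qubit_val w x q = qubit_val w y q) \<and>
      local_index w qs x = local_index w qs y"
    unfolding eq_iff_qubit_val[OF xy] local_index_eq_iff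
    using eq_iff_qubit_val[OF xy] by auto
  then show "apply_on w qs (mat_diag (2 ^ length qs) d) $$ (x, y) =
      mat_diag (2 ^ w) (\<lambda>x. d (local_index w qs x)) $$ (x, y)"
    using xy local_index_less[of w qs] by (auto simp: apply_on_def mat_diag_def)
qed (auto simp: apply_on_def mat_diag_def)

lemma mat_diag_power:
  fixes d :: "nat \<Rightarrow> 'a::semiring_1"
  shows "mat_diag n d ^\<^sub>m m = mat_diag n (\<lambda>i. d i ^ m)"
proof (induction m)
  case 0
  show ?case by (rule eq_matI) (auto simp: mat_diag_def)
next
  case (Suc m)
  then show ?case by (simp add: del: power_Suc add: power_Suc2)
qed

lemma mat_exp_mat_diag: "mat_exp (mat_diag n d) = mat_diag n (\<lambda>i. exp (d i))"
proof -
  have "(\<Sum>m. mat_diag n (\<lambda>i. d i ^ m) $$ (i, j) / fact m) = (if i = j then exp (d j) else 0)"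
    if "i < n" "j < n" for i j
    using that exp_converges[of "d j"]
    by (auto simp: mat_diag_def scaleR_conv_of_real divide_inverse mult.commute
        dest: sums_unique)
  then show ?thesis
    unfolding mat_exp_def mat_diag_power by (intro eq_matI) (auto simp: mat_diag_def)
qed

lemma smult_mat_diag: "(z::complex) \<cdot>\<^sub>m mat_diag n d = mat_diag n (\<lambda>i. z * d i)"
  by (rule eq_matI) (auto simp: mat_diag_def)

text \<open>The eigenvalues 1 and -1 of Z are rewritten so that the phase becomes an affine function
  of the bit.\<close>

lemma RZ_mat_eq: "RZ_mat \<phi> = mat_diag 2 (\<lambda>i. cis (\<phi> * (real i - 1 / 2)))"
proof -
  have "RZ_mat \<phi> = mat_diag 2 (\<lambda>i. exp (- \<i> * of_real \<phi> / 2 * (if i = 0 then 1 else - 1)))"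
    unfolding RZ_mat_def pauli_Z_def smult_mat_diag mat_exp_mat_diag ..
  also have "\<dots> = mat_diag 2 (\<lambda>i. cis (\<phi> * (real i - 1 / 2)))"
    by (rule eq_matI) (auto simp: mat_diag_def cis_conv_exp less_2_cases_iff)
  finally show ?thesis .
qed

lemma controlled_mat_diag:
  "controlled k (mat_diag 2 d) =
    mat_diag (2 ^ (k + 1)) (\<lambda>i. if i div 2 = 2 ^ k - 1 then d (i mod 2) else 1)"
proof -
  define e where "e = (2::nat) ^ k - 1"
  \<comment> \<open>With e the all-ones pattern of the controls, the block sizes become 2 * e and 2,
    and the subtraction in the size of the identity block disappears.\<close>
  have e: "2 ^ (k + 1) = 2 * e + 2" 
  proof -
    have "2 * b = 2 * (b - 1) + 2" if "b \<ge> 1" for b :: nat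
      using that by simp
    from this[of "2 ^ k"] show ?thesis by (simp add: e_def)
  qed
  have "i div 2 = e \<longleftrightarrow> \<not> i < 2 * e" "\<not> i < 2 * e \<Longrightarrow> i mod 2 = i - 2 * e"
    if "i < 2 * e + 2" for i
    using that by presburger+
  then show ?thesis
    unfolding controlled_def e Let_def e_def[symmetric]
    by (intro eq_matI) (auto simp: mat_diag_def)
qed

lemma local_index_eq_max_iff:
  "local_index w qs x = 2 ^ length qs - 1 \<longleftrightarrow> (\<forall>q\<in>set qs. qubit_val w x q = 1)"
proof (induction qs rule: rev_induct)
  case (snoc q qs)
  have "2 * a + u = 2 * b - 1 \<longleftrightarrow> a = b - 1 \<and> u = 1" if "u < 2" "b > 0" for a b u :: nat
    using that by presburger
  from this[of "qubit_val w x q" "2 ^ length qs" "local_index w qs x"] snoc show ?case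
    by (auto simp: local_index_snoc)
qed simp

section \<open>Phases of circuits of diagonal gates\<close>

text \<open>The product of the control bits is 1 exactly when all controls are on, so every phase is
  a polynomial in the bits of x. The value 0 for a query is a placeholder: the lemmas that read off
  a matrix from these phases exclude queries.\<close>

fun gate_phase :: "nat \<Rightarrow> gate \<Rightarrow> nat \<Rightarrow> real" where
  "gate_phase w (Query u qs) x = 0"
| "gate_phase w (Phase \<phi> q) x = \<phi> * real (qubit_val w x q)"
| "gate_phase w (RZ \<phi> cs q) x =
     \<phi> * (\<Prod>c\<leftarrow>cs. real (qubit_val w x c)) * (real (qubit_val w x q) - 1 / 2)"

lemma prod_list_qubit_val:
  "(\<Prod>c\<leftarrow>cs. real (qubit_val w x c)) = (if \<forall>c\<in>set cs. qubit_val w x c = 1 then 1 else 0)"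
proof (induction cs)
  case (Cons c cs)
  have "qubit_val w x c = 0 \<or> qubit_val w x c = 1"
    using qubit_val_less[of w x c] by linarith
  with Cons show ?case by auto
qed simp

lemma gate_mat_diag:
  assumes "\<not> is_query G"
  shows "gate_mat w U1 U2 G = mat_diag (2 ^ w) (\<lambda>x. cis (gate_phase w G x))"
proof (cases G)
  case (Query u qs)
  with assms show ?thesis by simp
next
  case (Phase \<phi> q)
  have "qubit_val w x q = 0 \<or> qubit_val w x q = 1" for x
    using qubit_val_less[of w x q] by linarith
  moreover have "local_index w [q] x = qubit_val w x q" for x
    by (simp add: local_index_def)
  moreover have "phase_mat \<phi> = mat_diag (2 ^ length [q]) (\<lambda>i. cis (\<phi> * real i))"
    by (rule eq_matI) (auto simp: phase_mat_def mat_diag_def cis_conv_exp less_2_cases_iff)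
  ultimately show ?thesis
    using Phase apply_on_mat_diag[of w "[q]" "\<lambda>i. cis (\<phi> * real i)"] by simp
next
  case (RZ \<phi> cs q)
  \<comment> \<open>The target is the last qubit of the list: u stands for the reading of the
    controls and v for the target bit.\<close>
  have "(2 * u + v) div 2 = u" "(2 * u + v) mod 2 = v" if "v < 2" for u v :: nat
    using that by auto
  with local_index_eq_max_iff[of w cs]
  have "(if local_index w (cs @ [q]) x div 2 = 2 ^ length cs - 1
      then cis (\<phi> * (real (local_index w (cs @ [q]) x mod 2) - 1 / 2)) else 1) =
      cis (gate_phase w G x)" for x
    by (simp add: RZ local_index_snoc prod_list_qubit_val)
  then show ?thesis
    using RZ apply_on_mat_diag[of w "cs @ [q]" "\<lambda>i. if i div 2 = 2 ^ length cs - 1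
      then cis (\<phi> * (real (i mod 2) - 1 / 2)) else 1"]
    by (simp add: RZ_mat_eq controlled_mat_diag)
qed

lemma circuit_mat_diag:
  assumes "\<forall>G\<in>set Gs. \<not> is_query G"
  shows "circuit_mat w U1 U2 Gs = mat_diag (2 ^ w) (\<lambda>x. cis (\<Sum>G\<leftarrow>Gs. gate_phase w G x))"
  using assms
proof (induction Gs)
  case Nil
  show ?case by (rule eq_matI) (auto simp: mat_diag_def)
next
  case (Cons G Gs)
  then show ?case by (simp add: gate_mat_diag mat_diag_diag cis_mult add.commute)
qed

lemma gate_mat_carrier: "gate_mat w U1 U2 G \<in> carrier_mat (2 ^ w) (2 ^ w)"
  by (cases G) (auto simp: apply_on_def)

lemma circuit_mat_carrier: "circuit_mat w U1 U2 Gs \<in> carrier_mat (2 ^ w) (2 ^ w)"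
  by (induction Gs) (auto intro!: mult_carrier_mat gate_mat_carrier)

lemma circuit_mat_append:
  "circuit_mat w U1 U2 (Gs @ Gs') = circuit_mat w U1 U2 Gs' * circuit_mat w U1 U2 Gs"
proof (induction Gs)
  case Nil
  show ?case using circuit_mat_carrier[of w U1 U2 Gs'] by simp
next
  case (Cons G Gs)
  then show ?case
    using assoc_mult_mat[OF circuit_mat_carrier circuit_mat_carrier gate_mat_carrier] by simp
qed

section \<open>Synthesis of the trilinear phase\<close>

text \<open>An \<open>RZ\<close> gate contributes \<open>b - 1/2\<close> rather than \<open>b\<close> for the target bit \<open>b\<close>; each
  gate below also absorbs the half left over by the gates with more controls.\<close>

definition trilinear_gates :: "nat \<Rightarrow> nat \<Rightarrow> nat \<Rightarrow> real \<Rightarrow> real \<Rightarrow> real \<Rightarrow> real \<Rightarrow> real \<Rightarrow> gate list" where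
  "trilinear_gates p q s u \<alpha> \<beta> \<gamma> \<delta> =
    [RZ (u * \<beta> * \<delta>) [p, q] s, RZ (u * \<alpha> * \<delta>) [p] s, RZ (u * \<beta> * (\<gamma> + \<delta> / 2)) [p] q,
     Phase (u * (\<alpha> + \<beta> / 2) * (\<gamma> + \<delta> / 2)) p]"

text \<open>Let b, b', b'' be the bits at p, q, s. The first two gates give u b (\<alpha> + \<beta>
  b') \<delta> (b'' - 1/2), the last two give u b (\<alpha> + \<beta> b') (\<gamma> + \<delta>/2),
  and the halves of \<delta> cancel.\<close>

lemma trilinear_gates_phase:
  "(\<Sum>G\<leftarrow>trilinear_gates p q s u \<alpha> \<beta> \<gamma> \<delta>. gate_phase w G x) =
    u * qubit_val w x p * (\<alpha> + \<beta> * qubit_val w x q) * (\<gamma> + \<delta> * qubit_val w x s)"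
  by (simp add: trilinear_gates_def field_simps)

text \<open>The indices p, q, s run over the bits of the registers l, j and m, in this order. The
  constants \<alpha> and \<gamma> are divided by n because each of the n bits of the register
  carries an equal share.\<close>

definition phase_circuit :: "nat \<Rightarrow> real \<Rightarrow> real \<Rightarrow> real \<Rightarrow> real \<Rightarrow> real \<Rightarrow> gate list" where
  "phase_circuit n u \<alpha> \<beta> \<gamma> \<delta> =
    concat (map (\<lambda>p. concat (map (\<lambda>q. concat (map (\<lambda>s.
      trilinear_gates (n + p) q (2 * n + s) (u * 2 ^ (n - 1 - p)) (\<alpha> / n) (\<beta> * 2 ^ (n - 1 - q))
        (\<gamma> / n) (\<delta> * 2 ^ (n - 1 - s)))
      [0..<n])) [0..<n])) [0..<n])"

lemma sum_list_map_concat_upt: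
  fixes h :: "'a \<Rightarrow> 'b::comm_monoid_add"
  shows "sum_list (map h (concat (map F [0..<n]))) = (\<Sum>p<n. sum_list (map h (F p)))"
  by (induction n) auto

lemma phase_circuit_phase:
  assumes "n \<ge> 1"
  shows "(\<Sum>G\<leftarrow>phase_circuit n u \<alpha> \<beta> \<gamma> \<delta>. gate_phase w G x) =
    u * local_index w [n..<n + n] x * (\<alpha> + \<beta> * local_index w [0..<n] x)
      * (\<gamma> + \<delta> * local_index w [2 * n..<2 * n + n] x)"
proof -
  \<comment> \<open>The n shares \<alpha> / n add up to \<alpha>; this is where n \<ge> 1
    enters.\<close>
  have aff: "\<alpha> + \<beta> * local_index w [a..<a + n] x =
      (\<Sum>q<n. \<alpha> / n + \<beta> * 2 ^ (n - 1 - q) * qubit_val w x (a + q))" 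
    for a and \<alpha> \<beta> :: real
    using assms by (simp add: local_index_upt_sum sum.distrib sum_distrib_left mult.assoc)
  have lin: "u * local_index w [n..<n + n] x =
      (\<Sum>p<n. u * 2 ^ (n - 1 - p) * qubit_val w x (n + p))"
    by (simp add: local_index_upt_sum sum_distrib_left mult.assoc)
  have prod: "(\<Sum>p<n. P p) * (\<Sum>q<n. Q q) * (\<Sum>s<n. S s) =
      (\<Sum>p<n. \<Sum>q<n. \<Sum>s<n. P p * Q q * S s)" for P Q S :: "nat \<Rightarrow> real"
    unfolding mult.assoc sum_product[of Q] unfolding sum_distrib_right[of P]
    unfolding sum_distrib_left ..
  show ?thesis
    unfolding lin aff[of \<gamma> \<delta> "2 * n"] aff[of \<alpha> \<beta> 0, unfolded add_0] prod
      phase_circuit_def sum_list_map_concat_upt trilinear_gates_phase ..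
qed

lemma length_phase_circuit: "length (phase_circuit n u \<alpha> \<beta> \<gamma> \<delta>) = 4 * n ^ 3"
proof -
  have "length (concat (map F [0..<n])) = n * m" if "\<And>i. length (F i) = m"
    for F :: "nat \<Rightarrow> gate list" and m
    by (induction n) (auto simp: that)
  note * = this
  show ?thesis
    unfolding phase_circuit_def
    by (subst *, (subst *)+, simp add: trilinear_gates_def, rule refl, rule refl)
       (simp add: power3_eq_cube)
qed

lemma phase_circuit_gates:
  assumes "G \<in> set (phase_circuit n u \<alpha> \<beta> \<gamma> \<delta>)"
  shows "\<not> is_query G" and "valid_gate n (3 * n) G"
  using assms by (auto simp: phase_circuit_def trilinear_gates_def)

section \<open>Matrix entries indexed by three registers\<close>

text \<open>Division with remainder by b. Applied twice, it turns a sum over all basis indices into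
  a triple sum over the register values.\<close>

lemma sum_lessThan_mult:
  fixes f :: "nat \<Rightarrow> 'a::comm_monoid_add"
  shows "(\<Sum>x<a * b. f x) = (\<Sum>i<a. \<Sum>j<b. f (i * b + j))"
proof -
  have "sum f {i * b..<i * b + b} = (\<Sum>j<b. f (i * b + j))" for i
    using sum.shift_bounds_nat_ivl[of f 0 "i * b" b]
    by (simp add: lessThan_atLeast0 add.commute)
  then show ?thesis by (simp flip: sum.nat_group)
qed

text \<open>The qubits outside \<open>qs\<close> are exactly those of \<open>rs\<close> and
  \<open>ss\<close>, so agreement there means that these two registers hold equal values.\<close>

lemma apply_on_index:
  assumes "set qs \<inter> (set rs \<union> set ss) = {}" "set qs \<union> set rs \<union> set ss = {..<w}" "x < 2 ^ w" "y < 2 ^ w"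
  shows "apply_on w qs V $$ (x, y) =
    (if local_index w rs x = local_index w rs y \<and> local_index w ss x = local_index w ss y
     then V $$ (local_index w qs x, local_index w qs y) else 0)"
proof -
  have "(\<forall>q<w. q \<notin> set qs \<longrightarrow> qubit_val w x q = qubit_val w y q) \<longleftrightarrow>
      local_index w rs x = local_index w rs y \<and> local_index w ss x = local_index w ss y"
    unfolding local_index_eq_iff using assms(1,2) by blast
  then show ?thesis using assms by (simp add: apply_on_def)
qed

lemma mult_mat_index_sum:
  assumes "A \<in> carrier_mat nr k" "B \<in> carrier_mat k nc" "i < nr" "j < nc"
  shows "(A * B) $$ (i, j) = (\<Sum>z<k. A $$ (i, z) * B $$ (z, j))"
  using assms by (simp add: scalar_prod_def lessThan_atLeast0)

lemma mat_adjoint_index: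
  fixes A :: "complex mat"
  assumes "A \<in> carrier_mat nr nc"
  shows "mat_adjoint A = mat nc nr (\<lambda>(i, j). cnj (A $$ (j, i)))"
  using assms by (intro eq_matI) (auto simp: mat_adjoint_def mat_of_rows_def conjugate_complex_def)

lemma mat_adjoint_mat_diag: "mat_adjoint (mat_diag n d) = mat_diag n (\<lambda>i. cnj (d i))"
  unfolding mat_adjoint_index[OF mat_diag_dim] by (rule eq_matI) (auto simp: mat_diag_def)

lemma bra_eq: "bra N j = mat 1 N (\<lambda>(_, i). if i = j then 1 else 0)"
  unfolding bra_def using mat_adjoint_index[of "ket N j" N 1]
  by (auto simp: ket_def intro!: eq_matI)

section \<open>Projection onto the zero state of the registers j and l\<close>

text \<open>In base N the digits of x are the values of the three registers, the system register
  being the last.\<close>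

lemma high_digits_zero_iff:
  fixes x i N :: nat
  assumes "i < N"
  shows "x div N div N = 0 \<and> x div N mod N = 0 \<and> x mod N = i \<longleftrightarrow> x = i"
proof
  assume *: "x div N div N = 0 \<and> x div N mod N = 0 \<and> x mod N = i"
  then have "x div N = 0" using div_mult_mod_eq[of "x div N" N] by simp
  then show "x = i" using * div_mult_mod_eq[of x N] by simp
qed (use assms in simp)

text \<open>The index with register values 0, 0, i is i itself, so preparing zeros is the inclusion
  of the first N coordinates.\<close>

lemma kron_ket_zero:
  assumes "N > 0"
  shows "kron (kron (ket N 0) (ket N 0)) (1\<^sub>m N) =
    mat (N * N * N) N (\<lambda>(x, i). if x = i then 1 else 0)"
proof (rule eq_matI)
  fix x i assume "x < dim_row (mat (N * N * N) N (\<lambda>(x, i). if x = i then 1 else 0 :: complex))"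
    "i < dim_col (mat (N * N * N) N (\<lambda>(x, i). if x = i then 1 else 0 :: complex))"
  then have "x < N * N * N" "i < N" by auto
  moreover have "x div N < N * N" "x div N div N < N"
    using calculation by (auto simp: less_mult_imp_div_less)
  ultimately show "kron (kron (ket N 0) (ket N 0)) (1\<^sub>m N) $$ (x, i) =
      mat (N * N * N) N (\<lambda>(x, i). if x = i then 1 else 0) $$ (x, i)"
    using high_digits_zero_iff[of i N x] assms by (auto simp: kron_def ket_def)
qed (auto simp: kron_def ket_def)

lemma kron_bra_zero:
  assumes "N > 0"
  shows "kron (kron (bra N 0) (bra N 0)) (1\<^sub>m N) =
    mat N (N * N * N) (\<lambda>(i, x). if x = i then 1 else 0)"
proof (rule eq_matI)
  fix i x assume "i < dim_row (mat N (N * N * N) (\<lambda>(i, x). if x = i then 1 else 0 :: complex))"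
    "x < dim_col (mat N (N * N * N) (\<lambda>(i, x). if x = i then 1 else 0 :: complex))"
  then have "x < N * N * N" "i < N" by auto
  moreover have "x div N < N * N" "x div N div N < N"
    using calculation by (auto simp: less_mult_imp_div_less)
  ultimately show "kron (kron (bra N 0) (bra N 0)) (1\<^sub>m N) $$ (i, x) =
      mat N (N * N * N) (\<lambda>(i, x). if x = i then 1 else 0) $$ (i, x)"
    using high_digits_zero_iff[of i N x] assms by (auto simp: kron_def bra_eq)
qed (auto simp: kron_def bra_eq)

text \<open>The block of W at zero in both registers is therefore its upper left N by N
  corner.\<close>

lemma kron_block_index:
  assumes "W \<in> carrier_mat (N * N * N) (N * N * N)" "i < N" "j < N"
  shows "(kron (kron (bra N 0) (bra N 0)) (1\<^sub>m N) * W * kron (kron (ket N 0) (ket N 0)) (1\<^sub>m N)) $$ (i, j)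
    = W $$ (i, j)"
proof -
  let ?B = "mat N (N * N * N) (\<lambda>(i, x). if x = i then 1 else 0) :: complex mat"
  let ?K = "mat (N * N * N) N (\<lambda>(x, i). if x = i then 1 else 0) :: complex mat"
  have N: "N > 0" using assms by simp
  have le: "N \<le> N * N * N" by simp
  have ij: "i < N * N * N" "j < N * N * N" using assms le by linarith+
  have B: "?B \<in> carrier_mat N (N * N * N)" and K: "?K \<in> carrier_mat (N * N * N) N" by auto
  have BW: "(?B * W) $$ (i, x) = W $$ (i, x)" if "x < N * N * N" for x
  proof -
    have "(?B * W) $$ (i, x) = (\<Sum>z<N * N * N. if z = i then W $$ (z, x) else 0)"
      unfolding mult_mat_index_sum[OF B assms(1,2) that]
      using assms by (intro sum.cong) auto
    then show ?thesis using ij by simp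
  qed
  have "(?B * W * ?K) $$ (i, j) = (\<Sum>z<N * N * N. if z = j then W $$ (i, z) else 0)"
    unfolding mult_mat_index_sum[OF mult_carrier_mat[OF B assms(1)] K assms(2,3)]
    using assms BW by (intro sum.cong) auto
  then show ?thesis
    using ij by (simp add: kron_ket_zero[OF N] kron_bra_zero[OF N])
qed

section \<open>The two queries and the sandwiched diagonal\<close>

lemma register_index_less:
  fixes j l m N :: nat
  assumes "j < N" "l < N" "m < N"
  shows "(j * N + l) * N + m < N * N * N"
proof -
  have *: "a * N + b < c * N" if "a < c" "b < N" for a b c :: nat
  proof -
    have "a * N + b < Suc a * N" using that by simp
    also have "\<dots> \<le> c * N" using that by (intro mult_le_mono1) simp
    finally show ?thesis .
  qed
  show ?thesis by (intro * assms)
qed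

lemma local_index_registers:
  assumes "j < 2 ^ n" "l < 2 ^ n" "m < 2 ^ n"
  defines "x \<equiv> (j * 2 ^ n + l) * 2 ^ n + m"
  shows "local_index (3 * n) [0..<n] x = j"
    and "local_index (3 * n) [n..<n + n] x = l"
    and "local_index (3 * n) [2 * n..<2 * n + n] x = m"
proof -
  have "x div 2 ^ n = j * 2 ^ n + l" unfolding x_def using assms by simp
  moreover have "x div 2 ^ (2 * n) = x div 2 ^ n div 2 ^ n"
    by (simp add: div_mult2_eq mult_2 power_add)
  ultimately have "x div 2 ^ (2 * n) = j" "x div 2 ^ n mod 2 ^ n = l" "x mod 2 ^ n = m"
    using assms by (auto simp: x_def)
  then show "local_index (3 * n) [0..<n] x = j"
    "local_index (3 * n) [n..<n + n] x = l"
    "local_index (3 * n) [2 * n..<2 * n + n] x = m"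
    using local_index_upt[of 0 n "3 * n" x] local_index_upt[of n n "3 * n" x]
      local_index_upt[of "2 * n" n "3 * n" x] assms by auto
qed

text \<open>A column index below N has zeros in the registers j and l. So U contributes its column 0
  and leaves l at zero, then V contributes its column 0; neither touches the system
  register.\<close>

lemma query_pair_index:
  fixes n :: nat
  defines "N \<equiv> 2 ^ n"
  assumes "j < N" "l < N" "m < N" "m' < N"
  shows "(apply_on (3 * n) [n..<n + n] V * apply_on (3 * n) [0..<n] U) $$ ((j * N + l) * N + m, m') =
    (if m = m' then U $$ (j, 0) * V $$ (l, 0) else 0)"
proof -
  let ?w = "3 * n"
  let ?A = "apply_on ?w [n..<n + n] V" and ?B = "apply_on ?w [0..<n] U"
  have w: "2 ^ ?w = N * N * N"
    by (simp add: N_def mult.commute[of 3] power_mult power3_eq_cube)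
  have car: "?A \<in> carrier_mat (N * N * N) (N * N * N)" "?B \<in> carrier_mat (N * N * N) (N * N * N)"
    by (auto simp: apply_on_def w)
  note lt = register_index_less[where N = N]
  note li = local_index_registers[where n = n, folded N_def]
  have m': "m' < N * N * N" and N0: "0 < N" using lt[of 0 0 m'] assms by auto
  have sets: "set [n..<n + n] \<inter> (set [0..<n] \<union> set [2 * n..<2 * n + n]) = {}"
      "set [n..<n + n] \<union> set [0..<n] \<union> set [2 * n..<2 * n + n] = {..<?w}"
      "set [0..<n] \<inter> (set [n..<n + n] \<union> set [2 * n..<2 * n + n]) = {}"
      "set [0..<n] \<union> set [n..<n + n] \<union> set [2 * n..<2 * n + n] = {..<?w}"
    by auto
  have A: "?A $$ ((j * N + l) * N + m, (a * N + b) * N + c) =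
      (if j = a \<and> m = c then V $$ (l, b) else 0)" if "a < N" "b < N" "c < N" for a b c
    using apply_on_index[OF sets(1,2), of "(j * N + l) * N + m" "(a * N + b) * N + c" V]
      that assms(2-5) lt li by (simp add: w)
  \<comment> \<open>Here the column m' is read as (0 * N + 0) * N + m'.\<close>
  have B: "?B $$ ((a * N + b) * N + c, m') = (if b = 0 \<and> c = m' then U $$ (a, 0) else 0)"
    if "a < N" "b < N" "c < N" for a b c
  proof -
    define x where "x = (a * N + b) * N + c"
    have "x < N * N * N" "local_index ?w [0..<n] x = a" "local_index ?w [n..<n + n] x = b"
      "local_index ?w [2 * n..<2 * n + n] x = c"
      using lt[OF that] li[OF that] by (simp_all only: x_def)
    then show ?thesis
      using apply_on_index[OF sets(3,4), of x m' U] assms(5) m' N0 li[of 0 0 m']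
      unfolding x_def[symmetric] by (simp add: w)
  qed
  have "(?A * ?B) $$ ((j * N + l) * N + m, m') =
      (\<Sum>a<N. \<Sum>b<N. \<Sum>c<N. ?A $$ ((j * N + l) * N + m, (a * N + b) * N + c) *
        ?B $$ ((a * N + b) * N + c, m'))"
    unfolding mult_mat_index_sum[OF car lt[OF assms(2-4)] m'] sum_lessThan_mult ..
  \<comment> \<open>The conditions are nested in the order of the sums, the innermost index first,
    so that each sum collapses to a single term.\<close>
  also have "\<dots> = (\<Sum>a<N. \<Sum>b<N. \<Sum>c<N. if c = m' then if b = 0 then if a = j then
      if m = m' then U $$ (j, 0) * V $$ (l, 0) else 0 else 0 else 0 else 0)"
    by (intro sum.cong refl) (auto simp: A B)
  also have "\<dots> = (if m = m' then U $$ (j, 0) * V $$ (l, 0) else 0)"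
    using assms(2-5) N0 by (simp add: sum.delta)
  finally show ?thesis .
qed

text \<open>The block is diagonal because no factor changes the system register. Each pair j, l
  meets the same amplitude on the way in and on the way out, which gives the squares.\<close>

lemma sandwich_block:
  fixes n :: nat
  defines "N \<equiv> 2 ^ n"
  assumes U: "U1 \<in> carrier_mat N N" "U2 \<in> carrier_mat N N"
    and Gs: "\<forall>G\<in>set Gs. \<not> is_query G"
    and phase: "\<And>j l m. j < N \<Longrightarrow> l < N \<Longrightarrow> m < N \<Longrightarrow>
      (\<Sum>G\<leftarrow>Gs. gate_phase (3 * n) G ((j * N + l) * N + m)) = \<theta> j l m"
    and m: "m < N" "m' < N"
  shows "circuit_mat (3 * n) U1 U2 ([Query U1_gate [0..<n], Query U2_gate [n..<n + n]] @ Gs @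
      [Query U2T_gate [n..<n + n], Query U1T_gate [0..<n]]) $$ (m, m') =
    (if m = m' then \<Sum>j<N. \<Sum>l<N. (U1 $$ (j, 0))\<^sup>2 * (U2 $$ (l, 0))\<^sup>2 * cis (\<theta> j l m) else 0)"
proof -
  let ?w = "3 * n"
  let ?A = "apply_on ?w [n..<n + n] U2" and ?B = "apply_on ?w [0..<n] U1"
  define M where "M = ?A * ?B"
  define d where "d x = cis (\<Sum>G\<leftarrow>Gs. gate_phase ?w G x)" for x
  let ?D = "mat_diag (N * N * N) d"
  have w: "2 ^ ?w = N * N * N"
    by (simp add: N_def mult.commute[of 3] power_mult power3_eq_cube)
  have car: "?A \<in> carrier_mat (N * N * N) (N * N * N)" "?B \<in> carrier_mat (N * N * N) (N * N * N)"
    by (auto simp: apply_on_def w)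
  have M: "M \<in> carrier_mat (N * N * N) (N * N * N)" unfolding M_def using car by simp
  have MT: "transpose_mat (?A * ?B) = transpose_mat ?B * transpose_mat ?A"
    using car by (rule transpose_mult)
  have tr: "apply_on ?w [n..<n + n] (transpose_mat U2) = transpose_mat ?A"
      "apply_on ?w [0..<n] (transpose_mat U1) = transpose_mat ?B"
    using U by (auto simp: N_def intro!: apply_on_transpose)
  have Mi: "M $$ ((j * N + l) * N + a, i) = (if a = i then U1 $$ (j, 0) * U2 $$ (l, 0) else 0)"
    if "j < N" "l < N" "a < N" "i < N" for j l a i
    unfolding M_def using query_pair_index[where n = n, folded N_def, OF that] .
  have di: "d ((j * N + l) * N + a) = cis (\<theta> j l a)" if "j < N" "l < N" "a < N" for j l a
    unfolding d_def using phase[OF that] by simp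
  have D: "circuit_mat ?w U1 U2 Gs = ?D"
    using circuit_mat_diag[OF Gs, of ?w U1 U2] by (simp add: w d_def[abs_def])
  \<comment> \<open>Transposition reverses products, so the query to the transpose of
    \<open>U2\<close> precedes the one to the transpose of \<open>U1\<close>.\<close>
  have "circuit_mat ?w U1 U2 ([Query U1_gate [0..<n], Query U2_gate [n..<n + n]] @ Gs @
      [Query U2T_gate [n..<n + n], Query U1T_gate [0..<n]]) = transpose_mat M * ?D * M"
    unfolding circuit_mat_append D
    using car by (simp add: tr MT w M_def)
  also have "\<dots> $$ (m, m') = (\<Sum>x<N * N * N. M $$ (x, m) * d x * M $$ (x, m'))"
  proof -
    have lt: "m < N * N * N" "m' < N * N * N"
      using register_index_less[of 0 N 0] m by auto
    have TD: "transpose_mat M * ?D = mat (N * N * N) (N * N * N) (\<lambda>(i, j). transpose_mat M $$ (i, j) * d j)"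
      using M by (intro mat_diag_mult_right) auto
    then have "transpose_mat M * ?D \<in> carrier_mat (N * N * N) (N * N * N)" by auto
    from mult_mat_index_sum[OF this M lt] show ?thesis
      unfolding TD using M lt by simp
  qed
  also have "\<dots> = (\<Sum>j<N. \<Sum>l<N. \<Sum>a<N. M $$ ((j * N + l) * N + a, m) *
      d ((j * N + l) * N + a) * M $$ ((j * N + l) * N + a, m'))"
    unfolding sum_lessThan_mult ..
  also have "\<dots> = (\<Sum>j<N. \<Sum>l<N. \<Sum>a<N. if a = m then if m = m' then
      (U1 $$ (j, 0))\<^sup>2 * (U2 $$ (l, 0))\<^sup>2 * cis (\<theta> j l m) else 0 else 0)"
    using m by (intro sum.cong refl) (simp add: Mi di power2_eq_square)
  also have "\<dots> = (if m = m' then \<Sum>j<N. \<Sum>l<N.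
      (U1 $$ (j, 0))\<^sup>2 * (U2 $$ (l, 0))\<^sup>2 * cis (\<theta> j l m) else 0)"
    using m by (simp add: sum.delta)
  finally show ?thesis .
qed

section \<open>Amplitudes, Hermitian parts and exponentials\<close>

text \<open>Applying U to the zero state extracts its column 0, the only column that enters the
  block.\<close>

lemma state_amplitude:
  assumes "U \<in> carrier_mat N N" "U * ket N 0 = msum N 1 (\<lambda>j. r j \<cdot>\<^sub>m ket N j) {..<N}" "j < N"
  shows "U $$ (j, 0) = r j"
proof -
  have ket: "ket N 0 \<in> carrier_mat N 1" by (simp add: ket_def)
  have "(U * ket N 0) $$ (j, 0) = (\<Sum>z<N. if z = 0 then U $$ (j, z) else 0)"
    unfolding mult_mat_index_sum[OF assms(1) ket assms(3) less_one[THEN iffD2, OF refl]]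
    by (intro sum.cong) (auto simp: ket_def)
  moreover have "msum N 1 (\<lambda>j. r j \<cdot>\<^sub>m ket N j) {..<N} $$ (j, 0) = (\<Sum>i<N. if i = j then r i else 0)"
  proof -
    have "(\<Sum>i<N. r i * (if j = i then 1 else 0)) = (\<Sum>i<N. if i = j then r i else 0)"
      by (intro sum.cong) auto
    then show ?thesis using assms(3) by (simp add: msum_def ket_def)
  qed
  ultimately show ?thesis using assms(2,3) by simp
qed

lemma hermitian_parts:
  fixes a :: "nat \<Rightarrow> real" and N :: nat
  defines "A \<equiv> mat_diag N (\<lambda>m. complex_of_real (a m) + \<i> * of_real (a m))"
  shows "(1 / 2) \<cdot>\<^sub>m (A + mat_adjoint A) = mat_diag N (\<lambda>m. of_real (a m))"
    and "(1 / (2 * \<i>)) \<cdot>\<^sub>m (A - mat_adjoint A) = mat_diag N (\<lambda>m. of_real (a m))"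
  unfolding A_def mat_adjoint_mat_diag
  by (auto intro!: eq_matI simp: mat_diag_def complex_eq_iff)

text \<open>Since L and H are the same diagonal matrix, k L + H is k + 1 times it.\<close>

lemma mat_exp_lchs:
  "mat_exp ((- \<i> * of_real t) \<cdot>\<^sub>m (of_real k \<cdot>\<^sub>m mat_diag N (\<lambda>m. complex_of_real (a m))
      + mat_diag N (\<lambda>m. of_real (a m)))) = mat_diag N (\<lambda>m. cis (- t * (k + 1) * a m))"
proof -
  have "(- \<i> * of_real t) \<cdot>\<^sub>m (of_real k \<cdot>\<^sub>m mat_diag N (\<lambda>m. complex_of_real (a m))
      + mat_diag N (\<lambda>m. of_real (a m))) = mat_diag N (\<lambda>m. \<i> * of_real (- t * (k + 1) * a m))"
    by (rule eq_matI) (auto simp: mat_diag_def algebra_simps)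
  then show ?thesis by (simp only: mat_exp_mat_diag cis_conv_exp)
qed

section \<open>Assembly of the circuit\<close>

text \<open>The coefficients are kept general: the amplitudes enter only through their squares, so
  every choice of square roots yields the same block.\<close>

lemma lchs_circuit:
  fixes n N :: nat and C D :: real and a :: "nat \<Rightarrow> real" and A L H :: "complex mat"
    and K T :: real and k t :: "nat \<Rightarrow> real" and c c' r r' :: "nat \<Rightarrow> complex"
  assumes n: "n \<ge> 1" and N: "N = 2 ^ n" and a: "a = (\<lambda>m. C + real m * D)"
    and A: "A = mat_diag N (\<lambda>m. of_real (a m) + \<i> * of_real (a m))"
    and L: "L = (1 / 2) \<cdot>\<^sub>m (A + mat_adjoint A)"
    and H: "H = (1 / (2 * \<i>)) \<cdot>\<^sub>m (A - mat_adjoint A)"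
    and k: "k = k_node K N" and t: "t = t_node T N"
    and r: "\<forall>j<N. (r j)\<^sup>2 = c j / of_real (one_norm N c)"
    and r': "\<forall>l<N. (r' l)\<^sup>2 = c' l / of_real (one_norm N c')"
    and U: "unitary_mat N U1" "unitary_mat N U2"
    and U1: "U1 * ket N 0 = msum N 1 (\<lambda>j. r j \<cdot>\<^sub>m ket N j) {..<N}"
    and U2: "U2 * ket N 0 = msum N 1 (\<lambda>l. r' l \<cdot>\<^sub>m ket N l) {..<N}"
  shows "\<exists>Gs. (\<forall>G\<in>set Gs. valid_gate n (3 * n) G) \<and>
      (\<forall>u. query_count u Gs = 1) \<and>
      real (elementary_count Gs) \<le> 4 * (log 2 (real N)) ^ 3 \<and>
      kron (kron (bra N 0) (bra N 0)) (1\<^sub>m N) * circuit_mat (3 * n) U1 U2 Gs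
          * kron (kron (ket N 0) (ket N 0)) (1\<^sub>m N) =
        (1 / of_real (one_norm N c * one_norm N c')) \<cdot>\<^sub>m
          msum N N (\<lambda>j. msum N N (\<lambda>l. (c j * c' l) \<cdot>\<^sub>m
            mat_exp ((- \<i> * of_real (t l)) \<cdot>\<^sub>m (of_real (k j) \<cdot>\<^sub>m L + H))) {..<N}) {..<N}"
proof -
  \<comment> \<open>The arguments come from -t_l = (-T/N) l, k_j + 1 = (1 - K) + (2K/N) j and a_m =
    C + D m.\<close>
  define Ps where "Ps = phase_circuit n (- T / N) (1 - K) (2 * K / N) C D"
  define Gs where "Gs = [Query U1_gate [0..<n], Query U2_gate [n..<n + n]] @ Ps @
      [Query U2T_gate [n..<n + n], Query U1T_gate [0..<n]]"
  let ?lhs = "kron (kron (bra N 0) (bra N 0)) (1\<^sub>m N) * circuit_mat (3 * n) U1 U2 Gs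
      * kron (kron (ket N 0) (ket N 0)) (1\<^sub>m N)"
  let ?rhs = "(1 / of_real (one_norm N c * one_norm N c')) \<cdot>\<^sub>m
      msum N N (\<lambda>j. msum N N (\<lambda>l. (c j * c' l) \<cdot>\<^sub>m
        mat_exp ((- \<i> * of_real (t l)) \<cdot>\<^sub>m (of_real (k j) \<cdot>\<^sub>m L + H))) {..<N}) {..<N}"
  have Ps: "\<forall>G\<in>set Ps. \<not> is_query G" "\<forall>G\<in>set Ps. valid_gate n (3 * n) G"
    unfolding Ps_def using phase_circuit_gates by blast+
  have valid: "\<forall>G\<in>set Gs. valid_gate n (3 * n) G"
    using Ps by (auto simp: Gs_def)
  have query: "\<forall>u. query_count u Gs = 1"
  proof
    fix u
    have "filter (\<lambda>G. \<exists>qs. G = Query u qs) Ps = []"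
      using Ps(1) by (auto simp: filter_empty_conv)
    then show "query_count u Gs = 1"
      by (cases u) (auto simp: query_count_def Gs_def)
  qed
  have "filter (\<lambda>G. \<not> is_query G) Ps = Ps"
    using Ps(1) by (simp add: filter_id_conv)
  \<comment> \<open>As log 2 N = n, the 4 n^3 gates of the phase circuit attain the bound
    exactly.\<close>
  then have count: "real (elementary_count Gs) \<le> 4 * (log 2 (real N)) ^ 3"
    by (simp add: elementary_count_def Gs_def N log_nat_power) (simp add: Ps_def length_phase_circuit)
  have Ucar: "U1 \<in> carrier_mat N N" "U2 \<in> carrier_mat N N"
    using U by (auto simp: unitary_mat_def)
  have w: "2 ^ (3 * n) = N * N * N"
    unfolding N by (simp add: mult.commute[of 3] power_mult power3_eq_cube)
  have Wcar: "circuit_mat (3 * n) U1 U2 Gs \<in> carrier_mat (N * N * N) (N * N * N)"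
    using circuit_mat_carrier[of "3 * n"] by (simp add: w)
  have phase: "(\<Sum>G\<leftarrow>Ps. gate_phase (3 * n) G ((j * N + l) * N + m)) = - t l * (k j + 1) * a m"
    if "j < N" "l < N" "m < N" for j l m
    using that local_index_registers[of j n l m] unfolding Ps_def phase_circuit_phase[OF n] N
    by (simp add: N[symmetric] t k a t_node_def k_node_def algebra_simps)
  have exp: "mat_exp ((- \<i> * of_real (t l)) \<cdot>\<^sub>m (of_real (k j) \<cdot>\<^sub>m L + H)) =
      mat_diag N (\<lambda>m. cis (- t l * (k j + 1) * a m))" for j l
    unfolding L H A hermitian_parts by (rule mat_exp_lchs)
  have "?lhs = ?rhs"
  proof (rule eq_matI)
    fix m m' assume "m < dim_row ?rhs" "m' < dim_col ?rhs"
    then have m: "m < N" "m' < N" by (auto simp: msum_def)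
    have "?lhs $$ (m, m') = (if m = m' then
        \<Sum>j<N. \<Sum>l<N. (r j)\<^sup>2 * (r' l)\<^sup>2 * cis (- t l * (k j + 1) * a m) else 0)"
      unfolding kron_block_index[OF Wcar m] unfolding Gs_def
      using sandwich_block[where n = n, folded N, OF Ucar Ps(1) phase m]
        state_amplitude[OF Ucar(1) U1] state_amplitude[OF Ucar(2) U2] by simp
    \<comment> \<open>The squares of the amplitudes are the coefficients over their one-norms; both
      norms move into the prefactor.\<close>
    also have "\<dots> = ?rhs $$ (m, m')"
      using m r r' unfolding exp
      by (auto simp: msum_def mat_diag_def sum_distrib_left intro!: sum.cong)
    finally show "?lhs $$ (m, m') = ?rhs $$ (m, m')" .
  qed (auto simp: msum_def kron_def bra_eq ket_def)
  with valid query count show ?thesis by blast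
qed

theorem mainTheorem1:
  shows "\<exists>c0::real. c0 > 0 \<and>
    (\<forall>(n::nat) (N::nat) (C::real) (D::real) (a::nat \<Rightarrow> real) (A::complex mat) (L::complex mat)
      (H::complex mat) (K::real) (T::real) (\<beta>::real) (g::real \<Rightarrow> complex)
      (k::nat \<Rightarrow> real) (t::nat \<Rightarrow> real) (c::nat \<Rightarrow> complex) (c'::nat \<Rightarrow> complex)
      (r::nat \<Rightarrow> complex) (r'::nat \<Rightarrow> complex) (U1::complex mat) (U2::complex mat).
      n \<ge> 1 \<and> N = 2 ^ n \<and>
      a = (\<lambda>m. C + real m * D) \<and> (\<forall>m<N. a m \<ge> 0) \<and>
      A = mat_diag N (\<lambda>m. of_real (a m) + \<i> * of_real (a m)) \<and>
      L = (1 / 2) \<cdot>\<^sub>m (A + mat_adjoint A) \<and>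
      H = (1 / (2 * \<i>)) \<cdot>\<^sub>m (A - mat_adjoint A) \<and>
      K > 0 \<and> T > 0 \<and> 0 < \<beta> \<and> \<beta> < 1 \<and>
      g absolutely_integrable_on {0..} \<and>
      k = k_node K N \<and> t = t_node T N \<and> c = k_coeff \<beta> K N \<and> c' = t_coeff g T N \<and>
      (\<exists>l<N. c' l \<noteq> 0) \<and>
      (\<forall>j<N. (r j)\<^sup>2 = c j / of_real (one_norm N c)) \<and>
      (\<forall>l<N. (r' l)\<^sup>2 = c' l / of_real (one_norm N c')) \<and>
      unitary_mat N U1 \<and> unitary_mat N U2 \<and>
      U1 * ket N 0 = msum N 1 (\<lambda>j. r j \<cdot>\<^sub>m ket N j) {..<N} \<and>
      U2 * ket N 0 = msum N 1 (\<lambda>l. r' l \<cdot>\<^sub>m ket N l) {..<N} \<longrightarrow>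
      (\<exists>Gs::gate list.
        (\<forall>G\<in>set Gs. valid_gate n (3 * n) G) \<and>
        (\<forall>u. query_count u Gs = 1) \<and>
        real (elementary_count Gs) \<le> c0 * (log 2 (real N)) ^ 3 \<and>
        kron (kron (bra N 0) (bra N 0)) (1\<^sub>m N) * circuit_mat (3 * n) U1 U2 Gs
            * kron (kron (ket N 0) (ket N 0)) (1\<^sub>m N) =
          (1 / of_real (one_norm N c * one_norm N c')) \<cdot>\<^sub>m
            msum N N (\<lambda>j. msum N N (\<lambda>l. (c j * c' l) \<cdot>\<^sub>m
              mat_exp ((- \<i> * of_real (t l)) \<cdot>\<^sub>m (of_real (k j) \<cdot>\<^sub>m L + H))) {..<N}) {..<N}))"
  \<comment> \<open>The constant 4 is the number of gates per trilinear term.\<close>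
  by (rule exI[of _ 4], intro conjI allI impI, simp, elim conjE, rule lchs_circuit) assumption+

end
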